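(* Let $n\ge1$ be an integer. There is a constant $c$, independent of $\theta$ and $k$, such that for any $k\in(0,\pi)$ other than $\frac{\pi}{2}$ the estimate $$T_n(\theta,k)\le\frac{c\,\theta^{2n}}{|\cos k|^{2(n-1)}}\qquad\text{as }\theta\to0$$ holds; that is, for every such $k$ there is $\theta_0=\theta_0(k)>0$ such that the inequality holds for all real $\theta$ with $0<|\theta|<\theta_0$.
   Context: For an integer $n\ge1$, $\theta\in\mathbb{R}\setminus\{0\}$ and $k\in\mathbb{R}$, consider the scattering problem $$\psi''+k^2\psi=0\ \text{ on }\mathbb{R}\setminus\{0,1,\dots,n-1\},\qquad \psi(j+0)=\theta\psi(j-0),\quad \psi'(j+0)=\theta^{-1}\psi'(j-0),\quad j=0,\dots,n-1,$$ with left scattering solution $\psi_-(x)=e^{ikx}+r_n(\theta,k)e^{-ikx}$ for $x<0$ and $\psi_-(x)=t_n(\theta,k)e^{ikx}$ for $x>n-1$. The reflection amplitude $r_n$ and transmission amplitude $t_n$ are determined (for all $k\in\mathbb{R}$) by $$\begin{bmatrix} t_n(\theta,k)\\0\end{bmatrix}=M_n(\theta,k)\begin{bmatrix}1\\ r_n(\theta,k)\end{bmatrix},\qquad M_n(\theta,k)=M(\theta,(n-1)k)\cdots M(\theta,2k)\,M(\theta,k)\,M(\theta,0),$$ where $$M(\theta,z)=\frac1{2\theta}\begin{bmatrix}\theta^2+1&(\theta^2-1)e^{-2iz}\\(\theta^2-1)e^{2iz}&\theta^2+1\end{bmatrix}.$$ The transmission probability is $T_n(\theta,k)=|t_n(\theta,k)|^2$.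 *)

theory Defs
  imports "HOL-Analysis.Analysis"
begin

definition transfer_matrix :: "real \<Rightarrow> real \<Rightarrow> complex^2^2" where
  "transfer_matrix \<theta> z = (1 / (2 * \<theta>)) *\<^sub>R
     vector [vector [of_real (\<theta>\<^sup>2 + 1), of_real (\<theta>\<^sup>2 - 1) * exp (- 2 * \<i> * of_real z)],
             vector [of_real (\<theta>\<^sup>2 - 1) * exp (2 * \<i> * of_real z), of_real (\<theta>\<^sup>2 + 1)]]"

text \<open>The factor for the interface at \<open>x = j\<close> is applied after those for
  \<open>x = 0, \<dots>, j - 1\<close>, so later factors stand on the left.\<close>

fun total_transfer_matrix :: "nat \<Rightarrow> real \<Rightarrow> real \<Rightarrow> complex^2^2" where
  "total_transfer_matrix 0 \<theta> k = mat 1"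
| "total_transfer_matrix (Suc n) \<theta> k =
     transfer_matrix \<theta> (real n * k) ** total_transfer_matrix n \<theta> k"

definition scattering_amplitudes ::
    "nat \<Rightarrow> real \<Rightarrow> real \<Rightarrow> complex \<Rightarrow> complex \<Rightarrow> bool" where
  "scattering_amplitudes n \<theta> k r t \<longleftrightarrow>
     (vector [t, 0] :: complex^2) = total_transfer_matrix n \<theta> k *v vector [1, r]"

definition reflection_amplitude :: "nat \<Rightarrow> real \<Rightarrow> real \<Rightarrow> complex" where
  "reflection_amplitude n \<theta> k = (THE r. \<exists>t. scattering_amplitudes n \<theta> k r t)"

definition transmission_amplitude :: "nat \<Rightarrow> real \<Rightarrow> real \<Rightarrow> complex" where
  "transmission_amplitude n \<theta> k = (THE t. \<exists>r. scattering_amplitudes n \<theta> k r t)"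

definition transmission_probability :: "nat \<Rightarrow> real \<Rightarrow> real \<Rightarrow> real" where
  "transmission_probability n \<theta> k = (cmod (transmission_amplitude n \<theta> k))\<^sup>2"

text \<open>For \<open>\<theta> \<noteq> 0\<close> the total transfer matrix lies in $SU(1,1)$, so its lower right entry does not
  vanish and the amplitudes are well defined for every real \<open>k\<close>.\<close>

lemma total_transfer_matrix_SU11:
  fixes \<theta> k :: real
  assumes "\<theta> \<noteq> 0"
  defines "A \<equiv> \<lambda>n. total_transfer_matrix n \<theta> k"
  shows "A n $ 2 $ 2 = cnj (A n $ 1 $ 1) \<and> A n $ 2 $ 1 = cnj (A n $ 1 $ 2) \<and> det (A n) = 1"
proof (induction n)
  case 0
  show ?case unfolding A_def total_transfer_matrix.simps det_I by (simp add: mat_def)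
next
  case (Suc n)
  define B where "B = transfer_matrix \<theta> (real n * k)"
  have B: "B $ 1 $ 1 = of_real ((\<theta>\<^sup>2 + 1) / (2 * \<theta>))"
          "B $ 2 $ 2 = of_real ((\<theta>\<^sup>2 + 1) / (2 * \<theta>))"
          "B $ 1 $ 2 = of_real ((\<theta>\<^sup>2 - 1) / (2 * \<theta>)) * exp (- 2 * \<i> * of_real (real n * k))"
          "B $ 2 $ 1 = of_real ((\<theta>\<^sup>2 - 1) / (2 * \<theta>)) * exp (2 * \<i> * of_real (real n * k))"
    unfolding B_def transfer_matrix_def vector_scaleR_component
    by (simp_all add: scaleR_conv_of_real[where 'a = complex])
  have c: "B $ 2 $ 2 = cnj (B $ 1 $ 1)" "B $ 2 $ 1 = cnj (B $ 1 $ 2)"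
    by (simp_all add: B exp_cnj)
  have "exp (- 2 * \<i> * of_real (real n * k)) * exp (2 * \<i> * of_real (real n * k)) = (1 :: complex)"
    by (simp flip: exp_add)
  then have "det B = of_real (((\<theta>\<^sup>2 + 1) / (2 * \<theta>))\<^sup>2 - ((\<theta>\<^sup>2 - 1) / (2 * \<theta>))\<^sup>2)"
    unfolding det_2 B by (simp add: power2_eq_square mult_ac)
  also have "((\<theta>\<^sup>2 + 1) / (2 * \<theta>))\<^sup>2 - ((\<theta>\<^sup>2 - 1) / (2 * \<theta>))\<^sup>2 = 1"
    using assms(1) by (simp add: field_simps power2_eq_square)
  finally have d: "det B = 1" by simp
  have S: "A (Suc n) = B ** A n" by (simp add: A_def B_def)
  show ?case
    using Suc c d unfolding S det_mul
    by (simp add: matrix_matrix_mult_def sum_2)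
qed

lemma total_transfer_matrix_22_nonzero:
  assumes "\<theta> \<noteq> 0"
  shows "total_transfer_matrix n \<theta> k $ 2 $ 2 \<noteq> 0"
proof
  define A where "A = total_transfer_matrix n \<theta> k"
  assume "total_transfer_matrix n \<theta> k $ 2 $ 2 = 0"
  moreover have "A $ 2 $ 1 = cnj (A $ 1 $ 2)" "det A = 1"
    using total_transfer_matrix_SU11[OF assms, of n k] by (simp_all add: A_def)
  ultimately have "- (A $ 1 $ 2 * cnj (A $ 1 $ 2)) = 1"
    by (simp add: A_def det_2)
  then have "of_real (- (cmod (A $ 1 $ 2))\<^sup>2) = (of_real 1 :: complex)"
    by (simp only: complex_norm_square of_real_minus of_real_1)
  then have "- (cmod (A $ 1 $ 2))\<^sup>2 = 1"
    using of_real_eq_iff by blast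
  then show False
    using zero_le_power2[of "cmod (A $ 1 $ 2)"] by linarith
qed

lemma scattering_amplitudes_iff:
  "scattering_amplitudes n \<theta> k r t \<longleftrightarrow>
     t = total_transfer_matrix n \<theta> k $ 1 $ 1 + total_transfer_matrix n \<theta> k $ 1 $ 2 * r \<and>
     0 = total_transfer_matrix n \<theta> k $ 2 $ 1 + total_transfer_matrix n \<theta> k $ 2 $ 2 * r"
  by (simp add: scattering_amplitudes_def vec_eq_iff forall_2 matrix_vector_mult_def sum_2)

lemma scattering_amplitudes_unique:
  assumes "\<theta> \<noteq> 0"
  shows "scattering_amplitudes n \<theta> k r t \<longleftrightarrow>
    r = reflection_amplitude n \<theta> k \<and> t = transmission_amplitude n \<theta> k"
proof -
  define A where "A = total_transfer_matrix n \<theta> k"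
  define r0 where "r0 = - (A $ 2 $ 1 / A $ 2 $ 2)"
  define t0 where "t0 = A $ 1 $ 1 + A $ 1 $ 2 * r0"
  have nz: "A $ 2 $ 2 \<noteq> 0"
    using total_transfer_matrix_22_nonzero[OF assms] by (simp add: A_def)
  have r0: "0 = A $ 2 $ 1 + A $ 2 $ 2 * r \<longleftrightarrow> r = r0" for r
    using nz by (auto simp: r0_def field_simps eq_neg_iff_add_eq_0)
  have *: "scattering_amplitudes n \<theta> k r t \<longleftrightarrow> r = r0 \<and> t = t0" for r t
    unfolding scattering_amplitudes_iff A_def[symmetric] t0_def r0 by auto
  then show ?thesis
    by (simp add: reflection_amplitude_def transmission_amplitude_def)
qed

end

theory Submission imports Defs begin

text \<open>At \<open>\<theta> = 0\<close> each factor \<open>2\<theta> M(\<theta>, jk)\<close> degenerates to a rank one matrix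
  \<open>u\<^sub>j v\<^sub>j\<^sup>T\<close> with \<open>v\<^sub>j\<^sup>T u\<^sub>j\<^sub>-\<^sub>1 = 1 + exp (-2ik)\<close>, of modulus \<open>2 \<bar>cos k\<bar>\<close>. Hence the lower right entry of
  \<open>(2\<theta>)\<^sup>n M\<^sub>n\<close> tends in modulus to \<open>(2 \<bar>cos k\<bar>)\<^sup>n\<^sup>-\<^sup>1\<close>. Since \<open>det M\<^sub>n = 1\<close>, the transmission amplitude is
  the reciprocal of that entry of \<open>M\<^sub>n\<close>, and \<open>c = 16\<close> works: a factor \<open>4\<close> comes from replacing the limit
  by half of it, the other from \<open>2\<^sup>2\<^sup>n / 2\<^sup>2\<^sup>n\<^sup>-\<^sup>2\<close>.\<close>

text \<open>The second row of the scattering equation forces \<open>r = - A21 / A22\<close>;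
  inserted into the first row, this gives \<open>t = det A / A22\<close>.\<close>

lemma transmission_amplitude_eq_inverse:
  assumes "\<theta> \<noteq> 0"
  shows "transmission_amplitude n \<theta> k = inverse (total_transfer_matrix n \<theta> k $ 2 $ 2)"
proof -
  define A where "A = total_transfer_matrix n \<theta> k"
  have nz: "A $ 2 $ 2 \<noteq> 0"
    using total_transfer_matrix_22_nonzero[OF assms] by (simp add: A_def)
  have "A $ 1 $ 1 * A $ 2 $ 2 - A $ 1 $ 2 * A $ 2 $ 1 = 1"
    using total_transfer_matrix_SU11[OF assms, of n k] unfolding A_def det_2 by blast
  then have "scattering_amplitudes n \<theta> k (- (A $ 2 $ 1 / A $ 2 $ 2)) (inverse (A $ 2 $ 2))"
    unfolding scattering_amplitudes_iff A_def[symmetric] using nz by (simp add: field_simps)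
  then show ?thesis
    using scattering_amplitudes_unique[OF assms] by (simp add: A_def)
qed

text \<open>The power of \<open>2 * \<theta>\<close> absorbs the prefactor of every interface, so
  the recursion has coefficients that stay bounded as \<open>\<theta>\<close> tends to 0.
  Multiplication from the left acts on each column separately, which closes the recursion on the
  second one.\<close>

lemma total_transfer_matrix_Suc_column_2:
  fixes \<theta> k :: real
  assumes "\<theta> \<noteq> 0"
  defines "x \<equiv> \<lambda>n. of_real (2 * \<theta>) ^ n * total_transfer_matrix n \<theta> k $ 1 $ 2"
    and "y \<equiv> \<lambda>n. of_real (2 * \<theta>) ^ n * total_transfer_matrix n \<theta> k $ 2 $ 2"
  shows "x (Suc n) = of_real (\<theta>\<^sup>2 + 1) * x n + of_real (\<theta>\<^sup>2 - 1) * cis (- (2 * (real n * k))) * y n"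
    and "y (Suc n) = of_real (\<theta>\<^sup>2 - 1) * cis (2 * (real n * k)) * x n + of_real (\<theta>\<^sup>2 + 1) * y n"
proof -
  have *: "of_real (2 * \<theta>) * transfer_matrix \<theta> z $ 1 $ 1 = of_real (\<theta>\<^sup>2 + 1)"
    "of_real (2 * \<theta>) * transfer_matrix \<theta> z $ 2 $ 2 = of_real (\<theta>\<^sup>2 + 1)"
    "of_real (2 * \<theta>) * transfer_matrix \<theta> z $ 1 $ 2 = of_real (\<theta>\<^sup>2 - 1) * cis (- (2 * z))"
    "of_real (2 * \<theta>) * transfer_matrix \<theta> z $ 2 $ 1 = of_real (\<theta>\<^sup>2 - 1) * cis (2 * z)" for z
    using assms(1) unfolding transfer_matrix_def vector_scaleR_component
    by (simp_all add: scaleR_conv_of_real[where 'a = complex] cis_conv_exp mult_ac)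
  have "x (Suc n) =
      (of_real (2 * \<theta>) * transfer_matrix \<theta> (real n * k) $ 1 $ 1) * x n +
      (of_real (2 * \<theta>) * transfer_matrix \<theta> (real n * k) $ 1 $ 2) * y n"
    unfolding x_def y_def by (simp add: matrix_matrix_mult_def sum_2 algebra_simps)
  then show "x (Suc n) =
      of_real (\<theta>\<^sup>2 + 1) * x n + of_real (\<theta>\<^sup>2 - 1) * cis (- (2 * (real n * k))) * y n"
    by (simp only: *)
  have "y (Suc n) =
      (of_real (2 * \<theta>) * transfer_matrix \<theta> (real n * k) $ 2 $ 1) * x n +
      (of_real (2 * \<theta>) * transfer_matrix \<theta> (real n * k) $ 2 $ 2) * y n"
    unfolding x_def y_def by (simp add: matrix_matrix_mult_def sum_2 algebra_simps)
  then show "y (Suc n) =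
      of_real (\<theta>\<^sup>2 - 1) * cis (2 * (real n * k)) * x n + of_real (\<theta>\<^sup>2 + 1) * y n"
    by (simp only: *)
qed

lemma norm_one_plus_cis_double: "cmod (1 + cis (2 * k)) = 2 * \<bar>cos k\<bar>"
proof -
  have "1 + cis (2 * k) = of_real (2 * cos k) * cis k"
    by (simp add: complex_eq_iff cos_double_cos sin_double power2_eq_square)
  then show ?thesis
    by (simp add: norm_mult)
qed

text \<open>The limiting column lies in the range of the last rank one factor, spanned by
  \<open>(- cis (- (2 * (real n * k))), 1)\<close>. The induction needs this direction as well as
  the modulus of \<open>G\<close>, since both entries feed into the next step.\<close>

lemma tendsto_scaled_column_2:
  fixes k :: real
  shows "\<exists>G. cmod G = (2 * \<bar>cos k\<bar>) ^ n \<and>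
    ((\<lambda>\<theta>. of_real (2 * \<theta>) ^ Suc n * total_transfer_matrix (Suc n) \<theta> k $ 1 $ 2)
       \<longlongrightarrow> - cis (- (2 * (real n * k))) * G) (at 0) \<and>
    ((\<lambda>\<theta>. of_real (2 * \<theta>) ^ Suc n * total_transfer_matrix (Suc n) \<theta> k $ 2 $ 2) \<longlongrightarrow> G) (at 0)"
proof -
  define x where "x = (\<lambda>n \<theta>. of_real (2 * \<theta>) ^ n * total_transfer_matrix n \<theta> k $ 1 $ 2)"
  define y where "y = (\<lambda>n \<theta>. of_real (2 * \<theta>) ^ n * total_transfer_matrix n \<theta> k $ 2 $ 2)"
  \<comment> \<open>The coefficients tend to 1 and -1 times a phase. The recursion requires
    \<open>\<theta>\<close> nonzero, which holds throughout \<open>at 0\<close>.\<close>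
  have step: "(x (Suc n) \<longlongrightarrow> F - cis (- (2 * (real n * k))) * G) (at 0) \<and>
      (y (Suc n) \<longlongrightarrow> - cis (2 * (real n * k)) * F + G) (at 0)"
    if F: "(x n \<longlongrightarrow> F) (at 0)" and G: "(y n \<longlongrightarrow> G) (at 0)" for n F G
  proof (intro conjI)
    have ev: "\<forall>\<^sub>F \<theta> in at 0. x (Suc n) \<theta> =
        of_real (\<theta>\<^sup>2 + 1) * x n \<theta> + of_real (\<theta>\<^sup>2 - 1) * cis (- (2 * (real n * k))) * y n \<theta>"
      unfolding eventually_at_filter x_def y_def
      by (intro always_eventually allI impI total_transfer_matrix_Suc_column_2(1))
    have "((\<lambda>\<theta>. of_real (\<theta>\<^sup>2 + 1) * x n \<theta> + of_real (\<theta>\<^sup>2 - 1) * cis (- (2 * (real n * k))) * y n \<theta>)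
        \<longlongrightarrow> of_real (0\<^sup>2 + 1) * F + of_real (0\<^sup>2 - 1) * cis (- (2 * (real n * k))) * G) (at 0)"
      by (intro tendsto_intros F G)
    then show "(x (Suc n) \<longlongrightarrow> F - cis (- (2 * (real n * k))) * G) (at 0)"
      unfolding tendsto_cong[OF ev] by simp
    have ev: "\<forall>\<^sub>F \<theta> in at 0. y (Suc n) \<theta> =
        of_real (\<theta>\<^sup>2 - 1) * cis (2 * (real n * k)) * x n \<theta> + of_real (\<theta>\<^sup>2 + 1) * y n \<theta>"
      unfolding eventually_at_filter x_def y_def
      by (intro always_eventually allI impI total_transfer_matrix_Suc_column_2(2))
    have "((\<lambda>\<theta>. of_real (\<theta>\<^sup>2 - 1) * cis (2 * (real n * k)) * x n \<theta> + of_real (\<theta>\<^sup>2 + 1) * y n \<theta>)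
        \<longlongrightarrow> of_real (0\<^sup>2 - 1) * cis (2 * (real n * k)) * F + of_real (0\<^sup>2 + 1) * G) (at 0)"
      by (intro tendsto_intros F G)
    then show "(y (Suc n) \<longlongrightarrow> - cis (2 * (real n * k)) * F + G) (at 0)"
      unfolding tendsto_cong[OF ev] by simp
  qed
  have "\<exists>G. cmod G = (2 * \<bar>cos k\<bar>) ^ n \<and> (x (Suc n) \<longlongrightarrow> - cis (- (2 * (real n * k))) * G) (at 0) \<and>
    (y (Suc n) \<longlongrightarrow> G) (at 0)"
  proof (induction n)
    case 0
    have "(x 0 \<longlongrightarrow> 0) (at 0)" "(y 0 \<longlongrightarrow> 1) (at 0)"
      by (simp_all add: x_def y_def mat_def)
    from step[OF this] show ?case
      \<comment> \<open>The first interface has phase 1 and sends the column \<open>(0, 1)\<close>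
        to \<open>(-1, 1)\<close> in the limit.\<close>
      by (intro exI[of _ 1]) simp
  next
    case (Suc n)
    then obtain G where G: "cmod G = (2 * \<bar>cos k\<bar>) ^ n"
      "(x (Suc n) \<longlongrightarrow> - cis (- (2 * (real n * k))) * G) (at 0)" "(y (Suc n) \<longlongrightarrow> G) (at 0)"
      by blast
    \<comment> \<open>Phases of neighbouring interfaces differ by \<open>2 * k\<close>. With the
      lower entry of the column normalised to 1, each new interface multiplies \<open>G\<close> by
      \<open>1 + cis (2 * k)\<close>.\<close>
    have "cis (2 * (real (Suc n) * k)) * cis (- (2 * (real n * k))) = cis (2 * k)"
      by (simp add: cis_mult algebra_simps)
    moreover have "- a * (- b * G) + G = (1 + a * b) * G" for a b
      by (simp add: algebra_simps)
    ultimately have y_limit: "- cis (2 * (real (Suc n) * k)) * (- cis (- (2 * (real n * k))) * G) + G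
        = (1 + cis (2 * k)) * G"
      by metis
    \<comment> \<open>Pulling the new phase out of the upper entry leaves the same factor, so the
      column has the direction of the new range.\<close>
    have "cis (- (2 * (real (Suc n) * k))) * cis (2 * k) = cis (- (2 * (real n * k)))"
      by (simp add: cis_mult algebra_simps)
    moreover have "- (a * b) * G - a * G = - a * ((1 + b) * G)" for a b
      by (simp add: algebra_simps)
    ultimately have "- cis (- (2 * (real n * k))) * G - cis (- (2 * (real (Suc n) * k))) * G
        = - cis (- (2 * (real (Suc n) * k))) * ((1 + cis (2 * k)) * G)"
      by metis
    with y_limit show ?case
      using step[OF G(2,3)] G(1)
      by (intro exI[of _ "(1 + cis (2 * k)) * G"])
        (simp only: norm_mult norm_one_plus_cis_double power_Suc simp_thms)
  qed
  then show ?thesis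
    by (simp only: x_def y_def)
qed

theorem corollary1:
  fixes n :: nat
  assumes "n \<ge> 1"
  shows "\<exists>c::real. \<forall>k::real. 0 < k \<and> k < pi \<and> k \<noteq> pi / 2 \<longrightarrow>
    (\<exists>\<theta>\<^sub>0>0. \<forall>\<theta>::real. 0 < \<bar>\<theta>\<bar> \<and> \<bar>\<theta>\<bar> < \<theta>\<^sub>0 \<longrightarrow>
      transmission_probability n \<theta> k \<le> c * \<theta> ^ (2 * n) / \<bar>cos k\<bar> ^ (2 * (n - 1)))"
proof (rule exI[of _ 16], intro allI impI)
  fix k :: real
  assume k: "0 < k \<and> k < pi \<and> k \<noteq> pi / 2"
  obtain m where m: "n = Suc m"
    using assms by (cases n) auto
  \<comment> \<open>Injectivity of cosine on \<open>[0, pi]\<close> leaves \<open>pi / 2\<close> as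
    its only zero there. This makes the limit \<open>L\<close> positive.\<close>
  have "cos k \<noteq> 0"
  proof
    assume "cos k = 0"
    then have "k = pi / 2"
      using k cos_inj_pi[of k "pi / 2"] by simp
    with k show False by simp
  qed
  define L where "L = (2 * \<bar>cos k\<bar>) ^ m"
  have L: "L > 0"
    using \<open>cos k \<noteq> 0\<close> by (simp add: L_def)
  define y where "y = (\<lambda>\<theta>. of_real (2 * \<theta>) ^ n * total_transfer_matrix n \<theta> k $ 2 $ 2)"
  obtain G where "cmod G = L" "(y \<longlongrightarrow> G) (at 0)"
    using tendsto_scaled_column_2[of k m] unfolding y_def L_def m by blast
  then have "((\<lambda>\<theta>. cmod (y \<theta>)) \<longlongrightarrow> L) (at 0)"
    using tendsto_norm by fastforce
  \<comment> \<open>The radius \<open>\<theta>\<^sub>0\<close> extracted here depends on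
    \<open>k\<close>, whereas the constant 16 does not.\<close>
  then have "eventually (\<lambda>\<theta>. L / 2 < cmod (y \<theta>)) (at 0)"
    using L by (intro order_tendstoD(1)) auto
  then obtain \<theta>\<^sub>0 where \<theta>\<^sub>0: "\<theta>\<^sub>0 > 0"
    "\<And>\<theta>. \<theta> \<noteq> 0 \<Longrightarrow> \<bar>\<theta>\<bar> < \<theta>\<^sub>0 \<Longrightarrow> L / 2 < cmod (y \<theta>)"
    by (auto simp: eventually_at)
  have "transmission_probability n \<theta> k \<le> 16 * \<theta> ^ (2 * n) / \<bar>cos k\<bar> ^ (2 * (n - 1))"
    if \<theta>: "0 < \<bar>\<theta>\<bar> \<and> \<bar>\<theta>\<bar> < \<theta>\<^sub>0" for \<theta>
  proof -
    have "of_real (2 * \<theta>) ^ n \<noteq> (0 :: complex)"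
      using \<theta> by simp
    then have "transmission_amplitude n \<theta> k = of_real (2 * \<theta>) ^ n / y \<theta>"
      unfolding y_def using \<theta> transmission_amplitude_eq_inverse[of \<theta> n k]
      by (simp only: abs_zero zero_less_abs_iff nonzero_divide_mult_cancel_left inverse_eq_divide
          if_True HOL.simp_thms)
    then have "cmod (transmission_amplitude n \<theta> k) = (2 * \<bar>\<theta>\<bar>) ^ n / cmod (y \<theta>)"
      by (simp add: norm_divide norm_power norm_mult)
    also have "\<dots> \<le> (2 * \<bar>\<theta>\<bar>) ^ n / (L / 2)"
      using \<theta>\<^sub>0(2)[of \<theta>] \<theta> L by (intro divide_left_mono mult_pos_pos) auto
    \<comment> \<open>As \<open>n = Suc m\<close>, the numerator has one factor 2 more than
      \<open>L\<close>; halving \<open>L\<close> contributes the other.\<close>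
    also have "\<dots> = 4 * \<bar>\<theta>\<bar> ^ n / \<bar>cos k\<bar> ^ m"
      by (simp add: L_def m power_mult_distrib)
    finally have "transmission_probability n \<theta> k \<le> (4 * \<bar>\<theta>\<bar> ^ n / \<bar>cos k\<bar> ^ m)\<^sup>2"
      unfolding transmission_probability_def by (intro power_mono) auto
    also have "\<dots> = 16 * \<theta> ^ (2 * n) / \<bar>cos k\<bar> ^ (2 * (n - 1))"
      by (simp add: m power_divide power_mult_distrib power_mult[symmetric] mult.commute[of _ 2]
          power_even_abs del: power_Suc)
    finally show ?thesis .
  qed
  with \<theta>\<^sub>0(1) show "\<exists>\<theta>\<^sub>0>0. \<forall>\<theta>::real. 0 < \<bar>\<theta>\<bar> \<and> \<bar>\<theta>\<bar> < \<theta>\<^sub>0 \<longrightarrow>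
      transmission_probability n \<theta> k \<le> 16 * \<theta> ^ (2 * n) / \<bar>cos k\<bar> ^ (2 * (n - 1))"
    by blast
qed

end
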